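(* Let $0<\alpha<1$, $\tau>0$, let $K\ge1$ be an integer, and let $p_1,p_2,p_3\ge0$ be constants. For a positive integer $N$ put $\rho=\tau/N$ and $t_n=n\rho$. Assume that $\{z^n\}$ is a non-negative real sequence satisfying $$z^n\le p_3\rho\sum_{j=N+1}^nz^{j-N}+p_1+p_2\rho(1+\ln n)t_n^{\alpha-1},\qquad (k-1)N+1\le n\le kN,\ k=1,2,\dots,K.$$ Then, for $(k-1)N+1\le n\le kN$, $k=1,2,\dots,K$, $$z^n\le C\Big[kp_1+\rho\Big(\sum_{j=1}^{k-1}\big(1+\ln(n-jN)\big)+p_2(1+\ln n)t_n^{\alpha-1}\Big)\Big].$$
   Context: Empty sums are $0$ (so the first sum vanishes for $n\le N$). $C$ is a generic positive constant which may depend on the fixed data $\alpha,\tau,K,p_2,p_3$ but not on $N$, $\rho$, $n$, $p_1$ or the sequence $\{z^n\}$. *)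

theory Defs
  imports Complex_Main
begin

definition mesh_step :: "real \<Rightarrow> nat \<Rightarrow> real"
  where "mesh_step \<tau> N = \<tau> / real N"

definition mesh_pt :: "real \<Rightarrow> nat \<Rightarrow> nat \<Rightarrow> real"
  where "mesh_pt \<tau> N n = real n * mesh_step \<tau> N"

end

theory Submission imports Defs "HOL-Analysis.Analysis" begin

text \<open>
  On the block \<open>k\<close> the delayed sum only involves \<open>z i\<close> with \<open>i \<le> n - N\<close>, that is, earlier
  blocks, so the bound propagates from block to block with a constant multiplied by a
  bounded factor each time; after \<open>K\<close> blocks the constant is still independent of \<open>N\<close>.
  In the sum all logarithms are at most \<open>1 + ln (n - N)\<close>, the term \<open>j = 1\<close> of the claimed bound,
  and the weights \<open>\<rho> t\<^sub>i\<^bsup>\<alpha> - 1\<^esup>\<close> sum to at most \<open>(K \<tau>)\<^bsup>\<alpha>\<^esup> / \<alpha>\<close>.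
\<close>

text \<open>Young's inequality for \<open>x\<close> and \<open>x + 1\<close> with weights
  \<open>a\<close> and \<open>1 - a\<close> gives
  \<open>x powr a * (x + 1) powr (1 - a) \<le> x + 1 - a\<close>; multiply by
  \<open>(x + 1) powr (a - 1)\<close>. The bound makes the next sum telescope.\<close>

lemma powr_diff_Suc_ge:
  fixes a x :: real
  assumes "0 < a" "a < 1" "0 \<le> x"
  shows "a * (x + 1) powr (a - 1) \<le> (x + 1) powr a - x powr a"
proof -
  have "x powr a * (x + 1) powr (1 - a) \<le> a * x + (1 - a) * (x + 1)"
    using Youngs_inequality_0[of a "1 - a" x "x + 1"] assms by (cases "x = 0") auto
  also have "\<dots> = (x + 1) - a"
    by (simp add: algebra_simps)
  finally have "x powr a * (x + 1) powr (1 - a) * (x + 1) powr (a - 1)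
      \<le> ((x + 1) - a) * (x + 1) powr (a - 1)"
    by (rule mult_right_mono) simp
  moreover have "(x + 1) powr (1 - a) * (x + 1) powr (a - 1) = 1"
    using assms by (simp flip: powr_add)
  moreover have "(x + 1) * (x + 1) powr (a - 1) = (x + 1) powr a"
    using assms by (simp add: powr_mult_base)
  ultimately show ?thesis
    by (simp add: algebra_simps)
qed

lemma sum_powr_le:
  fixes a :: real
  assumes "0 < a" "a < 1"
  shows "(\<Sum>i = 1..m. real i powr (a - 1)) \<le> real m powr a / a"
proof (induction m)
  case (Suc m)
  have "a * real (Suc m) powr (a - 1) \<le> real (Suc m) powr a - real m powr a"
    using powr_diff_Suc_ge[OF assms, of "real m"] by (simp add: add.commute)
  then have "real (Suc m) powr (a - 1) \<le> (real (Suc m) powr a - real m powr a) / a"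
    using assms by (simp add: field_simps)
  then show ?case
    using Suc by (simp add: diff_divide_distrib)
qed simp

text \<open>Since \<open>h * h powr (a - 1) = h powr a\<close>, the step size enters only through
  the length \<open>m * h\<close>. This is why the final constant does not depend on
  \<open>N\<close>.\<close>

lemma sum_mesh_powr_le:
  fixes a h T :: real
  assumes "0 < a" "a < 1" "0 < h" "real m * h \<le> T"
  shows "h * (\<Sum>i = 1..m. (real i * h) powr (a - 1)) \<le> T powr a / a"
proof -
  have "h * (\<Sum>i = 1..m. (real i * h) powr (a - 1))
      = (h * h powr (a - 1)) * (\<Sum>i = 1..m. real i powr (a - 1))"
    using assms by (simp add: powr_mult sum_distrib_left mult_ac)
  also have "\<dots> = h powr a * (\<Sum>i = 1..m. real i powr (a - 1))"
    using assms by (simp add: powr_mult_base)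
  also have "\<dots> \<le> h powr a * (real m powr a / a)"
    using sum_powr_le assms by (intro mult_left_mono) auto
  also have "\<dots> = (real m * h) powr a / a"
    using assms by (simp add: powr_mult)
  also have "\<dots> \<le> T powr a / a"
    using assms by (intro divide_right_mono powr_mono2) auto
  finally show ?thesis .
qed

text \<open>The term \<open>j = 1\<close> of the claimed logarithmic sum. The value \<open>0\<close>
  for \<open>n \<le> N\<close> matches the empty sum of the first block.\<close>

definition delay_log :: "nat \<Rightarrow> nat \<Rightarrow> real"
  where "delay_log N n = (if n \<le> N then 0 else 1 + ln (real (n - N)))"

text \<open>The claimed bound with \<open>p\<close> for \<open>k * p\<close> and only one logarithm
  kept. It is free of the block index and reproduces itself under the delayed inequality.\<close>

definition delay_majorant :: "real \<Rightarrow> real \<Rightarrow> real \<Rightarrow> nat \<Rightarrow> real \<Rightarrow> nat \<Rightarrow> real"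
  where "delay_majorant a h q N p n =
    p + h * (delay_log N n + q * (1 + ln (real n)) * (real n * h) powr (a - 1))"

lemma delay_log_nonneg: "0 \<le> delay_log N n"
  by (simp add: delay_log_def)

lemma delay_log_le:
  assumes "1 \<le> n" "n \<le> m"
  shows "delay_log N n \<le> 1 + ln (real m)"
  using assms by (auto simp: delay_log_def)

text \<open>One block of the induction. In the new factor, \<open>1\<close> pays for the undelayed
  terms and the summand with \<open>D\<close> for the delayed sum.\<close>

lemma delay_step:
  fixes a h q p c T D :: real and z :: "nat \<Rightarrow> real"
  assumes a: "0 < a" "a < 1" and h: "0 < h" and q: "0 \<le> q" and p: "0 \<le> p"
    and c: "0 \<le> c" and D: "0 \<le> D" and n: "1 \<le> n" "real n * h \<le> T"
    and IH: "\<And>i. i \<in> {1..n - N} \<Longrightarrow> z i \<le> D * delay_majorant a h q N p i"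
    and z: "z n \<le> c * h * (\<Sum>j = N + 1..n. z (j - N)) + p
              + q * h * (1 + ln (real n)) * (real n * h) powr (a - 1)"
  shows "z n \<le> (1 + c * (T + q * (T powr a / a)) * D) * delay_majorant a h q N p n"
proof -
  define A where "A = T + q * (T powr a / a)"
  define B where "B = delay_majorant a h q N p"
  have "0 \<le> real n * h"
    using h by simp
  then have T: "0 \<le> T"
    using n by linarith
  then have A: "0 \<le> A"
    using a q by (simp add: A_def)
  have rest: "0 \<le> h * (q * (1 + ln (real n)) * (real n * h) powr (a - 1))"
    using h q n by simp
  have B_lower: "p + h * delay_log N n \<le> B n"
    using rest by (simp add: B_def delay_majorant_def algebra_simps)
  have "h * (\<Sum>j = N + 1..n. z (j - N)) \<le> D * A * (p + h * delay_log N n)"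
  proof (cases "n \<le> N")
    case True
    then show ?thesis
      using D A p by (simp add: delay_log_def)
  next
    case False
    define m where "m = n - N"
    define M where "M = 1 + ln (real m)"
    have m: "1 \<le> m" "m \<le> n" "n = m + N"
      using False by (auto simp: m_def)
    have M: "0 \<le> M" "delay_log N n = M"
      using m(1) False by (auto simp: M_def delay_log_def simp flip: m_def)
    have "real m * h \<le> real n * h"
      using h m by (intro mult_right_mono) auto
    then have mT: "real m * h \<le> T"
      using n by linarith
    \<comment> \<open>Both logarithms in \<open>B i\<close> are at most \<open>M\<close> because
      \<open>i \<le> m\<close>, so afterwards only the weight varies with \<open>i\<close>.\<close>
    have B_le: "B i \<le> p + h * M + q * h * M * (real i * h) powr (a - 1)" if i: "i \<in> {1..m}" for i
    proof -
      have "delay_log N i \<le> M"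
        using i delay_log_le[of i m N] by (simp add: M_def)
      moreover have "q * (1 + ln (real i)) * (real i * h) powr (a - 1)
          \<le> q * M * (real i * h) powr (a - 1)"
        using i q m by (intro mult_right_mono mult_left_mono) (auto simp: M_def)
      ultimately have "h * (delay_log N i + q * (1 + ln (real i)) * (real i * h) powr (a - 1))
          \<le> h * (M + q * M * (real i * h) powr (a - 1))"
        using h by (intro mult_left_mono) auto
      then show ?thesis
        by (simp add: B_def delay_majorant_def algebra_simps)
    qed
    have "(\<Sum>j = N + 1..n. z (j - N)) = (\<Sum>i = 1..m. z i)"
      using sum.shift_bounds_cl_nat_ivl[of "\<lambda>j. z (j - N)" 1 N m] m by (simp add: add.commute)
    then have "h * (\<Sum>j = N + 1..n. z (j - N)) = h * (\<Sum>i = 1..m. z i)"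
      by simp
    also have "\<dots> \<le> h * (\<Sum>i = 1..m. D * (p + h * M + q * h * M * (real i * h) powr (a - 1)))"
    proof (intro mult_left_mono sum_mono)
      fix i assume i: "i \<in> {1..m}"
      then have "z i \<le> D * B i"
        using IH by (simp add: B_def m_def)
      also have "\<dots> \<le> D * (p + h * M + q * h * M * (real i * h) powr (a - 1))"
        using B_le[OF i] D by (rule mult_left_mono)
      finally show "z i \<le> D * (p + h * M + q * h * M * (real i * h) powr (a - 1))" .
    qed (use h in simp)
    also have "\<dots> = D * (real m * h * (p + h * M)
        + q * h * M * (h * (\<Sum>i = 1..m. (real i * h) powr (a - 1))))"
      by (simp add: sum.distrib flip: sum_distrib_left) (simp add: algebra_simps)
    also have "\<dots> \<le> D * (T * (p + h * M) + q * h * M * (T powr a / a))"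
      using D M h p q mT sum_mesh_powr_le[OF a h mT]
      by (intro mult_left_mono add_mono mult_right_mono) auto
    also have "\<dots> \<le> D * (A * (p + h * M))"
    proof (intro mult_left_mono D)
      \<comment> \<open>Adding this term completes the left side to a multiple of
        \<open>p + h * M\<close>, which explains the choice of \<open>A\<close>.\<close>
      have "0 \<le> q * (T powr a / a) * p"
        using q a p by simp
      then show "T * (p + h * M) + q * h * M * (T powr a / a) \<le> A * (p + h * M)"
        by (simp add: A_def algebra_simps add_divide_distrib)
    qed
    finally show ?thesis
      by (simp add: M mult.assoc)
  qed
  also have "\<dots> \<le> D * A * B n"
    using B_lower D A by (intro mult_left_mono) auto
  finally have "c * (h * (\<Sum>j = N + 1..n. z (j - N))) \<le> c * (D * A * B n)"
    using c by (rule mult_left_mono)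
  moreover have "p + q * h * (1 + ln (real n)) * (real n * h) powr (a - 1) \<le> B n"
    using mult_nonneg_nonneg[of h "delay_log N n"] h delay_log_nonneg[of N n]
    by (simp add: B_def delay_majorant_def algebra_simps)
  ultimately have "z n \<le> c * (D * A * B n) + B n"
    using z by (simp add: mult.assoc)
  also have "\<dots> = (1 + c * A * D) * B n"
    by (simp add: algebra_simps)
  finally show ?thesis
    by (simp add: A_def B_def)
qed

theorem lemma4p5:
  fixes \<alpha> \<tau> p2 p3 :: real and K :: nat
  assumes "0 < \<alpha>" and "\<alpha> < 1" and "0 < \<tau>" and "1 \<le> K"
    and "0 \<le> p2" and "0 \<le> p3"
  shows "\<exists>C>0. \<forall>(N::nat) (p1::real) (z :: nat \<Rightarrow> real).
    1 \<le> N \<longrightarrow> 0 \<le> p1 \<longrightarrow>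
    (\<forall>n\<in>{1..K * N}. 0 \<le> z n) \<longrightarrow>
    (\<forall>k\<in>{1..K}. \<forall>n\<in>{(k - 1) * N + 1..k * N}.
        z n \<le> p3 * mesh_step \<tau> N * (\<Sum>j = N + 1..n. z (j - N)) + p1
             + p2 * mesh_step \<tau> N * (1 + ln (real n)) * mesh_pt \<tau> N n powr (\<alpha> - 1)) \<longrightarrow>
    (\<forall>k\<in>{1..K}. \<forall>n\<in>{(k - 1) * N + 1..k * N}.
        z n \<le> C * (real k * p1
             + mesh_step \<tau> N * ((\<Sum>j = 1..k - 1. 1 + ln (real n - real j * real N))
                 + p2 * (1 + ln (real n)) * mesh_pt \<tau> N n powr (\<alpha> - 1))))"
proof -
  define T where "T = real K * \<tau>"
  define A where "A = T + p2 * (T powr \<alpha> / \<alpha>)"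
  \<comment> \<open>Iterates the factor of \<open>delay_step\<close>. The start value only has to be
    positive, as no index precedes the first block.\<close>
  define D where "D k = ((\<lambda>d. 1 + p3 * A * d) ^^ k) 1" for k :: nat
  have A: "0 \<le> A"
    using assms by (simp add: A_def T_def)
  have D_Suc: "D (Suc k) = 1 + p3 * A * D k" for k
    by (simp add: D_def)
  have D_pos: "0 < D k" for k
  proof (induction k)
    case (Suc k)
    then have "0 \<le> p3 * A * D k"
      using A assms by simp
    then show ?case
      by (simp add: D_Suc)
  qed (simp add: D_def)
  show ?thesis
  proof (intro exI[of _ "D K"] conjI allI impI ballI D_pos)
    fix N :: nat and p1 :: real and z :: "nat \<Rightarrow> real" and k n :: nat
    assume N: "1 \<le> N" and p1: "0 \<le> p1"
      and hyp: "\<forall>k\<in>{1..K}. \<forall>n\<in>{(k - 1) * N + 1..k * N}.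
        z n \<le> p3 * mesh_step \<tau> N * (\<Sum>j = N + 1..n. z (j - N)) + p1
             + p2 * mesh_step \<tau> N * (1 + ln (real n)) * mesh_pt \<tau> N n powr (\<alpha> - 1)"
      and k: "k \<in> {1..K}" and n: "n \<in> {(k - 1) * N + 1..k * N}"
    define h where "h = mesh_step \<tau> N"
    have h: "0 < h" "real N * h = \<tau>"
      using N assms by (auto simp: h_def mesh_step_def)
    have pt: "mesh_pt \<tau> N i = real i * h" for i
      by (simp add: mesh_pt_def h_def)
    have z: "z i \<le> p3 * h * (\<Sum>j = N + 1..i. z (j - N)) + p1
        + p2 * h * (1 + ln (real i)) * (real i * h) powr (\<alpha> - 1)" if i: "i \<in> {1..K * N}" for i
    proof -
      \<comment> \<open>The block of \<open>i\<close> has number \<open>l + 1\<close>. Blocks end at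
        multiples of \<open>N\<close>, hence the shift by one before dividing.\<close>
      define l where "l = (i - 1) div N"
      have eq: "i - 1 = l * N + (i - 1) mod N"
        by (simp add: l_def)
      moreover have "(i - 1) mod N < N"
        using N by simp
      ultimately have "i \<in> {l * N + 1..(l + 1) * N}"
        using i by auto
      moreover have "l < K"
        using i N by (auto simp: l_def less_mult_imp_div_less)
      ultimately show ?thesis
        using hyp[rule_format, of "l + 1" i] by (simp add: pt flip: h_def)
    qed
    \<comment> \<open>The claim covers the first \<open>l\<close> blocks together, since the delayed
      sum reaches back through all of them: \<open>i \<le> Suc l * N\<close> gives
      \<open>i - N \<le> l * N\<close>.\<close>
    have bound: "z i \<le> D l * delay_majorant \<alpha> h p2 N p1 i" if "l \<le> K" "i \<in> {1..l * N}" for l i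
      using that
    proof (induction l arbitrary: i)
      case (Suc l)
      have "Suc l * N \<le> K * N"
        using Suc.prems by (intro mult_le_mono1)
      then have iK: "i \<in> {1..K * N}"
        using Suc.prems unfolding atLeastAtMost_iff by linarith
      then have "real i * h \<le> real (K * N) * h"
        using h by (intro mult_right_mono) (auto simp del: of_nat_mult)
      also have "\<dots> = T"
        using h by (simp add: T_def mult.assoc)
      finally have iT: "real i * h \<le> T" .
      have "z j \<le> D l * delay_majorant \<alpha> h p2 N p1 j" if "j \<in> {1..i - N}" for j
        using that Suc by auto
      then show ?case
        unfolding D_Suc A_def
        using assms h(1) p1 iT iK z[OF iK] D_pos[of l] by (intro delay_step) auto
    qed simp
    have sum_terms: "0 \<le> 1 + ln (real n - real j * real N)" if "j \<in> {1..k - 1}" for j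
    proof -
      have "j * N \<le> (k - 1) * N"
        using that by (intro mult_le_mono1) simp
      then have "j * N + 1 \<le> n"
        using n unfolding atLeastAtMost_iff by linarith
      then have "real (j * N + 1) \<le> real n"
        by (simp only: of_nat_le_iff)
      then show ?thesis
        by simp
    qed
    \<comment> \<open>If \<open>n > N\<close> then \<open>k \<ge> 2\<close>, so the term
      \<open>j = 1\<close> occurs in the sum, and the other terms are nonnegative.\<close>
    have log_le: "delay_log N n \<le> (\<Sum>j = 1..k - 1. 1 + ln (real n - real j * real N))"
    proof (cases "n \<le> N")
      case True
      then show ?thesis
        unfolding delay_log_def by (simp only: if_True) (rule sum_nonneg, rule sum_terms)
    next
      case False
      then have "k \<noteq> 1"
        using n by auto
      then have "1 \<in> {1..k - 1}"
        using k by auto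
      then have "1 + ln (real n - real 1 * real N)
          \<le> (\<Sum>j = 1..k - 1. 1 + ln (real n - real j * real N))"
        using sum_terms by (intro member_le_sum) auto
      then show ?thesis
        using False by (simp add: delay_log_def of_nat_diff)
    qed
    have "k * N \<le> K * N"
      using k by (intro mult_le_mono1) simp
    then have "n \<in> {1..K * N}"
      using n unfolding atLeastAtMost_iff by linarith
    then have "z n \<le> D K * delay_majorant \<alpha> h p2 N p1 n"
      using bound by simp
    also have "\<dots> \<le> D K * (real k * p1 + h * ((\<Sum>j = 1..k - 1. 1 + ln (real n - real j * real N))
        + p2 * (1 + ln (real n)) * (real n * h) powr (\<alpha> - 1)))"
      unfolding delay_majorant_def
    proof (intro order_refl mult_left_mono add_mono)
      show "p1 \<le> real k * p1"
        using k p1 mult_right_mono[of 1 "real k" p1] by simp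
    qed (use log_le h D_pos[of K] in auto)
    finally show "z n \<le> D K * (real k * p1
             + mesh_step \<tau> N * ((\<Sum>j = 1..k - 1. 1 + ln (real n - real j * real N))
                 + p2 * (1 + ln (real n)) * mesh_pt \<tau> N n powr (\<alpha> - 1)))"
      by (simp add: pt flip: h_def)
  qed
qed

end
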